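(* Let $d\in(0,\infty)$ and $0\le\psi<\tfrac{\pi}{2}$, let $$A=d\begin{bmatrix}\cos\psi&-\sin\psi\\ \sin\psi&\cos\psi\end{bmatrix}$$ acting on $\mathbb{R}^2$, and set $\sigma=d\cos\psi$, $\beta=d$. Let $\gamma\in(0,\infty)$, $\delta=\sqrt{1-\frac{4\gamma\sigma}{1+2\gamma\sigma+(\gamma\beta)^2}}$ and $\xi=\arctan_2\left(\frac{2\gamma\sqrt{\beta^2-\sigma^2}}{1-(\gamma\beta)^2}\right)$. Suppose that $B$ is maximally monotone on $\mathbb{R}^2$ and satisfies either of the following: (i) if $\alpha\in(0,1]$: $B=B_1$ with $R_{\gamma B_1}=\begin{bmatrix}\cos\xi&-\sin\xi\\ \sin\xi&\cos\xi\end{bmatrix}$; (ii) if $\alpha\in(1,\tfrac{2}{1+\delta})$: $B=B_2$ with $R_{\gamma B_2}=\begin{bmatrix}\cos(\pi-\xi)&\sin(\pi-\xi)\\ -\sin(\pi-\xi)&\cos(\pi-\xi)\end{bmatrix}$. Then the sequence $(z^k)$ generated by the Douglas-Rachford algorithm $z^{k+1}=\big((1-\alpha)\mathrm{Id}+\alpha R_{\gamma A}R_{\gamma B}\big)z^k$ for solving $0\in\gamma Ax+\gamma Bx$ converges exactly with the rate $|1-\alpha|+\alpha\delta$.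
   Context: $\mathbb{R}^2$ carries the Euclidean inner product. For a maximally monotone operator $M$, the resolvent is $J_M=(\mathrm{Id}+M)^{-1}$ and the reflected resolvent is $R_M=2J_M-\mathrm{Id}$. For a numerator $x\ge0$ and a denominator $y\in\mathbb{R}$, $\arctan_2\left(\tfrac{x}{y}\right)$ (a function of the pair $(x,y)$) is defined as $\arctan(x/y)$ if $y>0$, as $\arctan(x/y)+\pi$ if $y<0$, and as $\tfrac{\pi}{2}$ if $y=0$; its values lie in $[0,\pi]$. "Converges exactly with rate $\rho$" means that $(z^k)$ converges to a fixed point $\bar z$ of the iteration operator $(1-\alpha)\mathrm{Id}+\alpha R_{\gamma A}R_{\gamma B}$ and $\|z^{k+1}-\bar z\|=\rho\|z^k-\bar z\|$ for all $k\ge0$. *)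

theory Defs
  imports "HOL-Analysis.Analysis"
begin

text \<open>Operators are set-valued maps \<^typ>\<open>'a \<Rightarrow> 'a set\<close>; empty values are allowed.\<close>

definition monotone_operator :: "('a::real_inner \<Rightarrow> 'a set) \<Rightarrow> bool" where
  "monotone_operator M \<longleftrightarrow>
     (\<forall>x y. \<forall>u\<in>M x. \<forall>v\<in>M y. inner (x - y) (u - v) \<ge> 0)"

definition maximally_monotone :: "('a::real_inner \<Rightarrow> 'a set) \<Rightarrow> bool" where
  "maximally_monotone M \<longleftrightarrow> monotone_operator M \<and>
     (\<forall>N. monotone_operator N \<longrightarrow> (\<forall>x. M x \<subseteq> N x) \<longrightarrow> N = M)"

definition scale_operator :: "real \<Rightarrow> ('a::real_vector \<Rightarrow> 'a set) \<Rightarrow> 'a \<Rightarrow> 'a set" where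
  "scale_operator c M = (\<lambda>x. (\<lambda>u. c *\<^sub>R u) ` M x)"

definition Id_plus :: "('a::real_vector \<Rightarrow> 'a set) \<Rightarrow> 'a \<Rightarrow> 'a set" where
  "Id_plus M = (\<lambda>x. (\<lambda>u. x + u) ` M x)"

definition inverse_operator :: "('a \<Rightarrow> 'a set) \<Rightarrow> 'a \<Rightarrow> 'a set" where
  "inverse_operator M = (\<lambda>y. {x. y \<in> M x})"

definition matrix_operator :: "real^'n^'n \<Rightarrow> real^'n \<Rightarrow> (real^'n) set" where
  "matrix_operator S = (\<lambda>x. {S *v x})"

text \<open>
  By Minty's theorem, for a maximally monotone operator \<open>M\<close> on a Hilbert space every value of
  the set-valued inverse of \<open>Id + M\<close> is a singleton, so its resolvent is read as a function
  on the whole space. For other operators the value of \<open>the_elem\<close> may be unspecified.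
\<close>

definition resolvent :: "('a::real_inner \<Rightarrow> 'a set) \<Rightarrow> 'a \<Rightarrow> 'a" where
  "resolvent M = (\<lambda>x. the_elem (inverse_operator (Id_plus M) x))"

definition reflected_resolvent :: "('a::real_inner \<Rightarrow> 'a set) \<Rightarrow> 'a \<Rightarrow> 'a" where
  "reflected_resolvent M = (\<lambda>x. 2 *\<^sub>R resolvent M x - x)"

definition DR_operator ::
    "real \<Rightarrow> real \<Rightarrow> ('a::real_inner \<Rightarrow> 'a set) \<Rightarrow> ('a \<Rightarrow> 'a set) \<Rightarrow> 'a \<Rightarrow> 'a" where
  "DR_operator \<alpha> \<gamma> A B = (\<lambda>z. (1 - \<alpha>) *\<^sub>R z +
     \<alpha> *\<^sub>R reflected_resolvent (scale_operator \<gamma> A)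
            (reflected_resolvent (scale_operator \<gamma> B) z))"

definition converges_exactly_with_rate ::
    "('a::real_normed_vector \<Rightarrow> 'a) \<Rightarrow> (nat \<Rightarrow> 'a) \<Rightarrow> real \<Rightarrow> bool" where
  "converges_exactly_with_rate T z \<rho> \<longleftrightarrow>
     (\<exists>zbar. T zbar = zbar \<and> z \<longlonglongrightarrow> zbar \<and>
        (\<forall>k. norm (z (Suc k) - zbar) = \<rho> * norm (z k - zbar)))"

text \<open>The arguments are the numerator \<open>x\<close>, intended to be nonnegative, and the denominator \<open>y\<close>.\<close>

definition arctan2 :: "real \<Rightarrow> real \<Rightarrow> real" where
  "arctan2 x y = (if y > 0 then arctan (x / y)
                  else if y < 0 then arctan (x / y) + pi
                  else pi / 2)"

end

theory Submission
  imports Defs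
begin

text \<open>
  Identify \<open>\<real>\<^sup>2\<close> with the complex plane. Then \<open>\<gamma>A\<close> is multiplication by \<open>w = r e\<^sup>i\<^sup>\<psi>\<close> with
  \<open>r = \<gamma>d\<close>, so \<open>R\<^sub>\<gamma>\<^sub>A\<close> is multiplication by
  \<open>(1 - w) / (1 + w) = (1 - r\<^sup>2 - 2 i r sin \<psi>) / (1 + 2 r cos \<psi> + r\<^sup>2)\<close>.
  The modulus of this number is \<open>\<delta>\<close>, because
  \<open>(1 - r\<^sup>2)\<^sup>2 + (2 r sin \<psi>)\<^sup>2 = (1 + r\<^sup>2 + 2 r cos \<psi>) (1 + r\<^sup>2 - 2 r cos \<psi>)\<close>, and its argument is
  \<open>- \<xi>\<close> (unless it vanishes, which happens for \<open>w = 1\<close> and does no harm), so \<open>R\<^sub>\<gamma>\<^sub>A\<close> is \<open>\<delta>\<close> times the rotation by \<open>- \<xi>\<close>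
  (lemma \<open>reflected_resolvent_scaled_rotation\<close>). The operators \<open>R\<^sub>\<gamma>\<^sub>B\<close> are the rotations by \<open>\<xi>\<close>
  and by \<open>\<xi> - \<pi>\<close>, respectively; they undo the rotation in \<open>R\<^sub>\<gamma>\<^sub>A\<close> up to sign, which leaves
  \<open>R\<^sub>\<gamma>\<^sub>A R\<^sub>\<gamma>\<^sub>B = \<delta> Id\<close> in the first case and \<open>- \<delta> Id\<close> in the second. Hence the iteration operator
  is \<open>c Id\<close> with \<open>c = 1 - \<alpha> + \<alpha>\<delta>\<close> or \<open>c = 1 - \<alpha> - \<alpha>\<delta>\<close>. In both cases
  \<open>\<bar>c\<bar> = \<bar>1 - \<alpha>\<bar> + \<alpha>\<delta>\<close>, and the bounds on \<open>\<alpha>\<close> make this number less than 1, so the iterates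
  tend to the fixed point \<open>0\<close>.
\<close>

text \<open>The matrix of multiplication by the complex number \<open>a + i b\<close>.\<close>

definition complex_matrix :: "real \<Rightarrow> real \<Rightarrow> real^2^2" where
  "complex_matrix a b = vector [vector [a, - b], vector [b, a]]"

lemma complex_matrix_mult_vector:
  "complex_matrix a b *v x = vector [a * x $ 1 - b * x $ 2, b * x $ 1 + a * x $ 2]"
  by (simp add: complex_matrix_def vec_eq_iff forall_2 matrix_vector_mult_def sum_2)

lemma scaleR_complex_matrix:
  "c *\<^sub>R complex_matrix a b = complex_matrix (c * a) (c * b)"
  by (simp add: complex_matrix_def vec_eq_iff forall_2)

lemma complex_matrix_mult:
  "complex_matrix a b ** complex_matrix p q = complex_matrix (a * p - b * q) (a * q + b * p)"
  by (simp add: complex_matrix_def vec_eq_iff forall_2 matrix_matrix_mult_def sum_2)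

lemma complex_matrix_of_real: "complex_matrix a 0 *v x = a *\<^sub>R x"
  by (simp add: complex_matrix_mult_vector vec_eq_iff forall_2)

lemma scale_matrix_operator:
  "scale_operator c (matrix_operator S) = matrix_operator (c *\<^sub>R S)"
  by (simp add: scale_operator_def matrix_operator_def fun_eq_iff scaleR_matrix_vector_assoc)

lemma resolvent_matrix_operator:
  fixes S P :: "real^'n^'n"
  assumes inv: "(mat 1 + S) ** P = mat 1"
  shows "resolvent (matrix_operator S) x = P *v x"
proof -
  have inv': "P ** (mat 1 + S) = mat 1"
    using inv by (simp add: matrix_left_right_inverse)
  have "x = (mat 1 + S) *v y \<longleftrightarrow> y = P *v x" for y
    by (metis inv inv' matrix_vector_mul_assoc matrix_vector_mul_lid)
  then have "inverse_operator (Id_plus (matrix_operator S)) x = {P *v x}"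
    by (auto simp: inverse_operator_def Id_plus_def matrix_operator_def
        matrix_vector_mult_add_rdistrib)
  then show ?thesis
    by (simp add: resolvent_def)
qed

text \<open>
  The Cayley transform \<open>(1 - w) / (1 + w)\<close> at \<open>w = a + i b\<close>, with the denominator made real by
  the conjugate of \<open>1 + w\<close>.
\<close>

lemma reflected_resolvent_complex_matrix:
  fixes a b :: real
  defines "D \<equiv> (1 + a)\<^sup>2 + b\<^sup>2"
  assumes D: "D \<noteq> 0"
  shows "reflected_resolvent (matrix_operator (complex_matrix a b)) x
    = complex_matrix ((1 - a\<^sup>2 - b\<^sup>2) / D) (- (2 * b / D)) *v x"
proof -
  have "mat 1 + complex_matrix a b = complex_matrix (1 + a) b"
    by (simp add: complex_matrix_def vec_eq_iff forall_2 mat_def)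
  moreover have "(1 + a) * ((1 + a) / D) - b * (- (b / D)) = 1"
  proof -
    have "(1 + a) * ((1 + a) / D) - b * (- (b / D)) = ((1 + a)\<^sup>2 + b\<^sup>2) / D"
      by (simp add: power2_eq_square add_divide_distrib algebra_simps)
    then show ?thesis
      using D by (simp add: D_def)
  qed
  moreover have "(1 + a) * (- (b / D)) + b * ((1 + a) / D) = 0"
    by simp
  moreover have "complex_matrix 1 0 = mat 1"
    by (simp add: complex_matrix_def vec_eq_iff forall_2 mat_def)
  ultimately have "(mat 1 + complex_matrix a b) ** complex_matrix ((1 + a) / D) (- (b / D)) = mat 1"
    by (simp only: complex_matrix_mult)
  then have "resolvent (matrix_operator (complex_matrix a b)) x
      = complex_matrix ((1 + a) / D) (- (b / D)) *v x"
    by (rule resolvent_matrix_operator)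
  moreover have "2 * ((1 + a) / D) - 1 = (1 - a\<^sup>2 - b\<^sup>2) / D"
    using D by (simp add: D_def field_simps power2_eq_square)
  moreover have "2 *\<^sub>R (complex_matrix p q *v x) - x = complex_matrix (2 * p - 1) (2 * q) *v x" for p q
    by (simp add: complex_matrix_mult_vector vec_eq_iff forall_2 algebra_simps)
  moreover have "2 * (- (b / D)) = - (2 * b / D)"
    by simp
  ultimately show ?thesis
    by (simp only: reflected_resolvent_def)
qed

text \<open>
  Polar coordinates: \<open>arctan2 x y\<close> is an argument of \<open>y + i x\<close>. At the origin the factor
  \<open>sqrt (x\<^sup>2 + y\<^sup>2)\<close> vanishes, and for \<open>y = 0\<close> the sign condition on \<open>x\<close> is needed.
\<close>

lemma arctan2_polar:
  assumes "0 \<le> x"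
  shows "sqrt (x\<^sup>2 + y\<^sup>2) * cos (arctan2 x y) = y"
    and "sqrt (x\<^sup>2 + y\<^sup>2) * sin (arctan2 x y) = x"
proof -
  have "sqrt (x\<^sup>2 + y\<^sup>2) * cos (arctan2 x y) = y \<and> sqrt (x\<^sup>2 + y\<^sup>2) * sin (arctan2 x y) = x"
  proof (cases "y = 0")
    case True
    with assms show ?thesis
      by (simp add: arctan2_def)
  next
    case False
    have "x\<^sup>2 + y\<^sup>2 = (1 + (x / y)\<^sup>2) * y\<^sup>2"
      using False by (simp add: field_simps)
    then have s: "sqrt (x\<^sup>2 + y\<^sup>2) = sqrt (1 + (x / y)\<^sup>2) * \<bar>y\<bar>"
      by (simp add: real_sqrt_mult)
    have "sqrt (1 + (x / y)\<^sup>2) \<noteq> 0"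
      by (smt (verit) real_sqrt_eq_zero_cancel_iff zero_le_power2)
    then show ?thesis
      using False unfolding s by (simp add: arctan2_def cos_arctan sin_arctan)
  qed
  then show "sqrt (x\<^sup>2 + y\<^sup>2) * cos (arctan2 x y) = y"
    and "sqrt (x\<^sup>2 + y\<^sup>2) * sin (arctan2 x y) = x"
    by auto
qed

lemma reflected_resolvent_scaled_rotation:
  fixes r \<psi> :: real
  defines "\<delta> \<equiv> sqrt (1 - 4 * r * cos \<psi> / (1 + 2 * r * cos \<psi> + r\<^sup>2))"
    and "\<xi> \<equiv> arctan2 (2 * r * sin \<psi>) (1 - r\<^sup>2)"
  assumes r: "0 < r" and c: "0 < cos \<psi>" and s: "0 \<le> sin \<psi>"
  shows "reflected_resolvent (matrix_operator (complex_matrix (r * cos \<psi>) (r * sin \<psi>))) x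
    = complex_matrix (\<delta> * cos \<xi>) (- (\<delta> * sin \<xi>)) *v x"
    and "0 \<le> \<delta>" and "\<delta> < 1"
proof -
  define D where "D = 1 + 2 * r * cos \<psi> + r\<^sup>2"
  define S where "S = sqrt ((2 * r * sin \<psi>)\<^sup>2 + (1 - r\<^sup>2)\<^sup>2)"
  have rc: "0 < r * cos \<psi>"
    using r c by simp
  then have D: "0 < D"
    using zero_le_power2[of r] unfolding D_def by linarith
  have r2: "(r * cos \<psi>)\<^sup>2 + (r * sin \<psi>)\<^sup>2 = r\<^sup>2"
    by (simp add: power_mult_distrib flip: distrib_left)
  have quot: "1 - 4 * r * cos \<psi> / D = (D - 4 * r * cos \<psi>) / D"
    using D by (simp add: field_simps)
  have "D - 4 * r * cos \<psi> = (1 - r * cos \<psi>)\<^sup>2 + (r * sin \<psi>)\<^sup>2"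
    using r2 by (simp add: D_def power2_diff)
  then have nonneg: "0 \<le> 1 - 4 * r * cos \<psi> / D"
    using D quot by simp
  then show "0 \<le> \<delta>"
    by (simp add: \<delta>_def D_def)
  show "\<delta> < 1"
    using rc D by (simp add: \<delta>_def flip: D_def)
  have "(2 * r * sin \<psi>)\<^sup>2 + (1 - r\<^sup>2)\<^sup>2 = (1 + r\<^sup>2)\<^sup>2 - 4 * (r * cos \<psi>)\<^sup>2"
  proof -
    have "(2 * r * sin \<psi>)\<^sup>2 = 4 * r\<^sup>2 - 4 * (r * cos \<psi>)\<^sup>2"
      using r2 by (simp add: power_mult_distrib)
    then show ?thesis
      by (simp add: power2_eq_square algebra_simps)
  qed
  also have "\<dots> = D * (D - 4 * r * cos \<psi>)"
    by (simp add: D_def power2_eq_square algebra_simps)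
  also have "\<dots> = D\<^sup>2 * (1 - 4 * r * cos \<psi> / D)"
    using D by (simp add: quot power2_eq_square)
  finally have "S = D * \<delta>"
    using D by (simp add: S_def \<delta>_def D_def[symmetric] real_sqrt_mult)
  then have \<delta>: "\<delta> = S / D"
    using D by simp
  have "S * cos \<xi> = 1 - r\<^sup>2" "S * sin \<xi> = 2 * r * sin \<psi>"
    unfolding S_def \<xi>_def using r s by (auto intro!: arctan2_polar)
  then have "\<delta> * cos \<xi> = (1 - r\<^sup>2) / D" "\<delta> * sin \<xi> = 2 * (r * sin \<psi>) / D"
    by (simp_all add: \<delta>)
  moreover have "(1 + r * cos \<psi>)\<^sup>2 + (r * sin \<psi>)\<^sup>2 = D"
    using r2 by (simp add: D_def power2_sum)
  moreover have "1 - (r * cos \<psi>)\<^sup>2 - (r * sin \<psi>)\<^sup>2 = 1 - r\<^sup>2"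
    using r2 by simp
  ultimately show "reflected_resolvent (matrix_operator (complex_matrix (r * cos \<psi>) (r * sin \<psi>))) x
    = complex_matrix (\<delta> * cos \<xi>) (- (\<delta> * sin \<xi>)) *v x"
    using less_imp_neq[OF D, symmetric]
      reflected_resolvent_complex_matrix[of "r * cos \<psi>" "r * sin \<psi>" x]
    by (simp only: not_False_eq_True)
qed

lemma converges_exactly_with_rate_scaleR:
  fixes T :: "'a::real_normed_vector \<Rightarrow> 'a"
  assumes T: "\<And>x. T x = c *\<^sub>R x" and c: "\<bar>c\<bar> < 1" and z: "\<And>k. z (Suc k) = T (z k)"
  shows "converges_exactly_with_rate T z \<bar>c\<bar>"
proof -
  have "z k = c ^ k *\<^sub>R z 0" for k
    by (induction k) (simp_all add: z T)
  moreover have "(\<lambda>k. c ^ k *\<^sub>R z 0) \<longlonglongrightarrow> 0 *\<^sub>R z 0"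
    by (intro tendsto_intros LIMSEQ_power_zero) (simp add: c)
  ultimately have "z \<longlonglongrightarrow> 0"
    by (metis (no_types, lifting) ext scaleR_zero_left)
  then show ?thesis
    unfolding converges_exactly_with_rate_def by (intro exI[of _ 0]) (simp add: T z)
qed

theorem proposition6p9:
  fixes d \<psi> \<sigma> \<beta> \<gamma> \<delta> \<xi> \<alpha> :: real
    and A :: "real^2^2"
    and B :: "real^2 \<Rightarrow> (real^2) set"
    and z :: "nat \<Rightarrow> real^2"
  assumes d: "0 < d"
    and psi: "0 \<le> \<psi>" "\<psi> < pi / 2"
    and A: "A = d *\<^sub>R vector [vector [cos \<psi>, - sin \<psi>],
                             vector [sin \<psi>,   cos \<psi>]]"
    and sigma: "\<sigma> = d * cos \<psi>"
    and beta: "\<beta> = d"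
    and gamma: "0 < \<gamma>"
    and delta: "\<delta> = sqrt (1 - 4 * \<gamma> * \<sigma> / (1 + 2 * \<gamma> * \<sigma> + (\<gamma> * \<beta>)\<^sup>2))"
    and xi: "\<xi> = arctan2 (2 * \<gamma> * sqrt (\<beta>\<^sup>2 - \<sigma>\<^sup>2)) (1 - (\<gamma> * \<beta>)\<^sup>2)"
    and B_max: "maximally_monotone B"
    and B_cases:
      "(\<alpha> \<in> {0<..1} \<and>
        reflected_resolvent (scale_operator \<gamma> B) =
          (\<lambda>x. (vector [vector [cos \<xi>, - sin \<xi>],
                        vector [sin \<xi>,   cos \<xi>]] :: real^2^2) *v x)) \<or>
       (\<alpha> \<in> {1<..<2 / (1 + \<delta>)} \<and>
        reflected_resolvent (scale_operator \<gamma> B) =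
          (\<lambda>x. (vector [vector [cos (pi - \<xi>),   sin (pi - \<xi>)],
                        vector [- sin (pi - \<xi>), cos (pi - \<xi>)]] :: real^2^2) *v x))"
    and DR: "\<And>k. z (Suc k) = DR_operator \<alpha> \<gamma> (matrix_operator A) B (z k)"
  shows "converges_exactly_with_rate
           (DR_operator \<alpha> \<gamma> (matrix_operator A) B) z (\<bar>1 - \<alpha>\<bar> + \<alpha> * \<delta>)"
proof -
  define r where "r = \<gamma> * d"
  have r: "0 < r"
    using d gamma by (simp add: r_def)
  have cos: "0 < cos \<psi>" and sin: "0 \<le> sin \<psi>"
    using psi by (auto intro!: cos_gt_zero_pi sin_ge_zero)
  have "d\<^sup>2 - (d * cos \<psi>)\<^sup>2 = (d * sin \<psi>)\<^sup>2"
    by (simp add: power_mult_distrib sin_squared_eq algebra_simps)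
  then have "sqrt (\<beta>\<^sup>2 - \<sigma>\<^sup>2) = d * sin \<psi>"
    using d sin by (simp add: beta sigma)
  then have xi': "\<xi> = arctan2 (2 * r * sin \<psi>) (1 - r\<^sup>2)"
    by (simp add: xi beta r_def mult.assoc)
  have delta': "\<delta> = sqrt (1 - 4 * r * cos \<psi> / (1 + 2 * r * cos \<psi> + r\<^sup>2))"
    by (simp add: delta beta sigma r_def mult.assoc)
  note RA = reflected_resolvent_scaled_rotation[OF r cos sin, folded xi' delta']
  have A': "scale_operator \<gamma> (matrix_operator A)
      = matrix_operator (complex_matrix (r * cos \<psi>) (r * sin \<psi>))"
    unfolding A scale_matrix_operator complex_matrix_def[symmetric]
    by (simp add: scaleR_complex_matrix r_def mult.assoc)

  \<comment> \<open>Both choices of \<open>B\<close> make \<open>R\<^sub>\<gamma>\<^sub>B\<close> multiplication by \<open>\<epsilon> e\<^sup>i\<^sup>\<xi>\<close>, with \<open>\<epsilon> = 1\<close> and \<open>\<epsilon> = - 1\<close>, respectively.\<close>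
  obtain \<epsilon> where RB: "reflected_resolvent (scale_operator \<gamma> B) =
        (\<lambda>x. complex_matrix (\<epsilon> * cos \<xi>) (\<epsilon> * sin \<xi>) *v x)"
    and \<epsilon>: "\<epsilon> = 1 \<and> 0 < \<alpha> \<and> \<alpha> \<le> 1 \<or> \<epsilon> = - 1 \<and> 1 < \<alpha> \<and> \<alpha> < 2 / (1 + \<delta>)"
    using B_cases
  proof
    assume "\<alpha> \<in> {0<..1} \<and> reflected_resolvent (scale_operator \<gamma> B) =
          (\<lambda>x. (vector [vector [cos \<xi>, - sin \<xi>], vector [sin \<xi>, cos \<xi>]] :: real^2^2) *v x)"
    then show thesis
      by (intro that[of 1]) (simp_all add: complex_matrix_def)
  next
    assume "\<alpha> \<in> {1<..<2 / (1 + \<delta>)} \<and> reflected_resolvent (scale_operator \<gamma> B) =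
          (\<lambda>x. (vector [vector [cos (pi - \<xi>), sin (pi - \<xi>)],
                        vector [- sin (pi - \<xi>), cos (pi - \<xi>)]] :: real^2^2) *v x)"
    then show thesis
      by (intro that[of "- 1"]) (simp_all add: complex_matrix_def)
  qed

  define c where "c = 1 - \<alpha> + \<alpha> * (\<epsilon> * \<delta>)"
  have T: "DR_operator \<alpha> \<gamma> (matrix_operator A) B x = c *\<^sub>R x" for x
  proof -
    have "\<delta> * cos \<xi> * (\<epsilon> * cos \<xi>) - - (\<delta> * sin \<xi>) * (\<epsilon> * sin \<xi>)
        = \<epsilon> * \<delta> * ((cos \<xi>)\<^sup>2 + (sin \<xi>)\<^sup>2)"
      by algebra
    also have "\<dots> = \<epsilon> * \<delta>"
      by simp
    finally have "\<delta> * cos \<xi> * (\<epsilon> * cos \<xi>) - - (\<delta> * sin \<xi>) * (\<epsilon> * sin \<xi>) = \<epsilon> * \<delta>" .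
    moreover have "\<delta> * cos \<xi> * (\<epsilon> * sin \<xi>) + - (\<delta> * sin \<xi>) * (\<epsilon> * cos \<xi>) = 0"
      by simp
    ultimately have "complex_matrix (\<delta> * cos \<xi>) (- (\<delta> * sin \<xi>)) **
        complex_matrix (\<epsilon> * cos \<xi>) (\<epsilon> * sin \<xi>) = complex_matrix (\<epsilon> * \<delta>) 0"
      by (simp only: complex_matrix_mult)
    then have "DR_operator \<alpha> \<gamma> (matrix_operator A) B x
        = (1 - \<alpha>) *\<^sub>R x + \<alpha> *\<^sub>R complex_matrix (\<epsilon> * \<delta>) 0 *v x"
      by (simp add: DR_operator_def RB A' RA(1) matrix_vector_mul_assoc
          scaleR_matrix_vector_assoc)
    then show ?thesis
      by (simp add: complex_matrix_of_real c_def scaleR_complex_matrix algebra_simps)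
  qed

  have abs_c: "\<bar>c\<bar> = \<bar>1 - \<alpha>\<bar> + \<alpha> * \<delta>" and less: "\<bar>c\<bar> < 1"
  proof -
    have "0 < \<alpha>"
      using \<epsilon> by auto
    then have "0 \<le> \<alpha> * \<delta>" "\<alpha> * \<delta> < \<alpha>"
      using RA(2,3) by simp_all
    then show "\<bar>c\<bar> = \<bar>1 - \<alpha>\<bar> + \<alpha> * \<delta>"
      using \<epsilon> by (auto simp: c_def)
    have "\<alpha> + \<alpha> * \<delta> < 2" if "\<alpha> < 2 / (1 + \<delta>)"
      using that RA(2) by (simp add: pos_less_divide_eq distrib_left)
    then show "\<bar>c\<bar> < 1"
      using \<epsilon> \<open>0 \<le> \<alpha> * \<delta>\<close> \<open>\<alpha> * \<delta> < \<alpha>\<close> by (auto simp: c_def)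
  qed
  show ?thesis
    unfolding abs_c[symmetric] using T less DR by (rule converges_exactly_with_rate_scaleR)
qed

end
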